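(* Let $I\subseteq\mathbb{R}$ be an interval and let $a,b,c,f_4\in C^\infty(I)$ be real-valued with $c(x)\neq0$ and $f_4(x)\ne0$ on $I$. Suppose that for all $x\in I$ $$b(x)=\frac{1}{f_4(x)}\left[c(x)\frac{d}{dx}\left(\frac{f_4}{c}\right)(x)-\frac{f_4^2(x)}{2}-2a(x)c(x)\right].$$ Then the general solution of the Riccati equation $\frac{dy}{dx}=a(x)+b(x)y+c(x)y^2$ is $$y(x)=\frac{e^{\int^{x}\left\{\frac{1}{f_4(\phi)}\left[c(\phi)\frac{d}{d\phi}\left(\frac{f_4}{c}\right)-\frac{f_4^2(\phi)}{2}-2a(\phi)c(\phi)\right]+f_4(\phi)\right\}d\phi}}{C_{11}-\int^{x}c(\psi)\,e^{\int^{\psi}\left\{\frac{1}{f_4(\phi)}\left[c(\phi)\frac{d}{d\phi}\left(\frac{f_4}{c}\right)-\frac{f_4^2(\phi)}{2}-2a(\phi)c(\phi)\right]+f_4(\phi)\right\}d\phi}\,d\psi}+\frac{f_4(x)}{2c(x)},$$ where $C_{11}$ is an arbitrary constant of integration.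
   Context: $\int^{x}g(\phi)\,d\phi$ denotes a fixed antiderivative of $g$ on $I$, the same one wherever the same integrand occurs. "The general solution is $y(x)=\frac{G(x)}{C-H(x)}+y_p(x)$ with $C$ an arbitrary constant" means: for every real $C$, this function satisfies the equation on every subinterval of $I$ on which $C-H$ does not vanish; and conversely every differentiable solution on a nondegenerate subinterval of $I$ is either of this form for some real $C$ (with nonvanishing denominator there) or equal to $y_p$ (the limiting case $C=\infty$). *)

theory Defs
  imports "HOL-Analysis.Analysis"
begin

text \<open>
  Intervals may be open, half-open, closed or unbounded, so all derivatives are taken
  within the interval, i.e. they are one-sided at endpoints belonging to it.
\<close>

definition nondegenerate_interval :: "real set \<Rightarrow> bool" where
  "nondegenerate_interval I \<longleftrightarrow> is_interval I \<and> (\<exists>x\<in>I. \<exists>y\<in>I. x < y)"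

definition deriv_within :: "real set \<Rightarrow> (real \<Rightarrow> real) \<Rightarrow> real \<Rightarrow> real" where
  "deriv_within I f x = vector_derivative f (at x within I)"

definition smooth_on :: "real set \<Rightarrow> (real \<Rightarrow> real) \<Rightarrow> bool" where
  "smooth_on I f \<longleftrightarrow> (\<forall>n. (deriv_within I ^^ n) f differentiable_on I)"

definition antiderivative_on :: "real set \<Rightarrow> (real \<Rightarrow> real) \<Rightarrow> (real \<Rightarrow> real) \<Rightarrow> bool" where
  "antiderivative_on I g F \<longleftrightarrow> (\<forall>x\<in>I. (F has_real_derivative g x) (at x within I))"

definition riccati_solution_on ::
    "real set \<Rightarrow> (real \<Rightarrow> real) \<Rightarrow> (real \<Rightarrow> real) \<Rightarrow> (real \<Rightarrow> real) \<Rightarrow> (real \<Rightarrow> real) \<Rightarrow> bool" where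
  "riccati_solution_on J a b c y \<longleftrightarrow>
     (\<forall>x\<in>J. (y has_real_derivative a x + b x * y x + c x * (y x)\<^sup>2) (at x within J))"

text \<open>
  The general solution on \<open>I\<close> is \<open>G x / (C - H x) + yp x\<close> with \<open>C\<close> an arbitrary constant;
  the alternative \<open>y = yp\<close> in the converse is the limiting case \<open>C = \<infinity>\<close>.
\<close>

definition riccati_general_solution ::
    "real set \<Rightarrow> (real \<Rightarrow> real) \<Rightarrow> (real \<Rightarrow> real) \<Rightarrow> (real \<Rightarrow> real)
     \<Rightarrow> (real \<Rightarrow> real) \<Rightarrow> (real \<Rightarrow> real) \<Rightarrow> (real \<Rightarrow> real) \<Rightarrow> bool" where
  "riccati_general_solution I a b c G H yp \<longleftrightarrow>
     (\<forall>C J. is_interval J \<and> J \<subseteq> I \<and> (\<forall>x\<in>J. C - H x \<noteq> 0)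
        \<longrightarrow> riccati_solution_on J a b c (\<lambda>x. G x / (C - H x) + yp x)) \<and>
     (\<forall>J y. nondegenerate_interval J \<and> J \<subseteq> I \<and> riccati_solution_on J a b c y
        \<longrightarrow> (\<exists>C. \<forall>x\<in>J. C - H x \<noteq> 0 \<and> y x = G x / (C - H x) + yp x)
            \<or> (\<forall>x\<in>J. y x = yp x))"

lemma antiderivative_on_exists:
  assumes I: "is_interval I" and g: "continuous_on I g"
  shows "\<exists>F. antiderivative_on I g F"
proof (cases "I = {}")
  case True
  then show ?thesis by (simp add: antiderivative_on_def)
next
  case False
  then obtain x0 where x0: "x0 \<in> I" by blast
  define F where "F x = (if x0 \<le> x then integral {x0..x} g else - integral {x..x0} g)" for x
  have sub: "{u..v} \<subseteq> I" if "u \<in> I" "v \<in> I" for u v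
    using that I unfolding is_interval_1 by (meson atLeastAtMost_iff subsetI)
  have "(F has_real_derivative g x) (at x within I)" if x: "x \<in> I" for x
  proof -
    obtain u S where u: "u \<in> I" "u \<le> x" "u \<le> x0" "open S" "x \<in> S" "S \<inter> I \<subseteq> {u..}"
    proof (cases "\<exists>p\<in>I. p < x")
      case True
      then obtain p where "p \<in> I" "p < x" by blast
      then show thesis
        by (intro that[of "min p x0" "{p<..}"]) (use x0 in \<open>auto simp: min_def\<close>)
    next
      case False
      then have le: "\<And>p. p \<in> I \<Longrightarrow> x \<le> p" by (meson not_le_imp_less)
      show thesis by (rule that[of x UNIV]) (use x le le[OF x0] in auto)
    qed
    obtain v T where v: "v \<in> I" "x \<le> v" "x0 \<le> v" "open T" "x \<in> T" "T \<inter> I \<subseteq> {..v}"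
    proof (cases "\<exists>p\<in>I. x < p")
      case True
      then obtain p where "p \<in> I" "x < p" by blast
      then show thesis
        by (intro that[of "max p x0" "{..<p}"]) (use x0 in \<open>auto simp: max_def\<close>)
    next
      case False
      then have le: "\<And>p. p \<in> I \<Longrightarrow> p \<le> x" by (meson not_le_imp_less)
      show thesis by (rule that[of x UNIV]) (use x le le[OF x0] in auto)
    qed
    have cont: "continuous_on {u..v} g"
      using sub[OF u(1) v(1)] g continuous_on_subset by blast
    have int: "g integrable_on {p..q}" if "u \<le> p" "q \<le> v" for p q
      using that by (intro integrable_continuous_real continuous_on_subset[OF cont]) auto
    have F: "integral {u..t} g - integral {u..x0} g = F t" if "t \<in> {u..v}" for t
    proof (cases "x0 \<le> t")
      case True
      then show ?thesis
        using Henstock_Kurzweil_Integration.integral_combine[of u x0 t g] int[of u t] u v that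
        by (simp add: F_def)
    next
      case False
      then show ?thesis
        using Henstock_Kurzweil_Integration.integral_combine[of u t x0 g] int[of u x0] u v that
        by (simp add: F_def)
    qed
    have "((\<lambda>t. integral {u..t} g - integral {u..x0} g) has_real_derivative g x)
        (at x within {u..v})"
      using integral_has_real_derivative[OF cont, of x] u v
      by (auto intro!: derivative_eq_intros)
    then have "(F has_real_derivative g x) (at x within {u..v})"
      unfolding has_field_derivative_def
      by (rule has_derivative_transform[rotated 2]) (use F u v in auto)
    moreover have "at x within I = at x within {u..v}"
      by (rule at_within_nhd[of x "S \<inter> T"])
        (use u v sub[OF u(1) v(1)] in auto)
    ultimately show ?thesis by simp
  qed
  then show ?thesis unfolding antiderivative_on_def by blast
qed

end

theory Submission
  imports Defs
begin

text \<open>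
  Subtracting a particular solution \<open>yp\<close> from a solution \<open>y\<close> of
  \<open>y' = a + b y + c y\<^sup>2\<close> cancels \<open>a\<close>: the difference \<open>u\<close> satisfies the
  Bernoulli equation \<open>u' = g u + c u\<^sup>2\<close> with \<open>g = b + 2 c yp\<close>. If \<open>E' = g\<close>
  and \<open>u\<close> has no zeros, then \<open>exp E / u\<close> has derivative \<open>- c exp E = - H'\<close>, so it
  equals \<open>C - H\<close> for a constant \<open>C\<close>. This is where the form \<open>exp E / (C - H)\<close> comes from.
  A zero of \<open>u\<close> forces \<open>y = yp\<close> throughout: a given \<open>u\<close> also solves the linear equation
  \<open>w' = (g + c u) w\<close>, whose coefficient has an antiderivative, so \<open>u\<close> is a constant
  multiple of an exponential and vanishes everywhere or nowhere
  (\<open>bernoulli_solution_zero_or_nonzero\<close>).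

  All of this holds for any particular solution
  (\<open>riccati_general_solution_from_particular\<close>). The hypothesis on \<open>b\<close> says exactly that
  \<open>f4 / (2 c)\<close> is one, and with this choice \<open>g = b + f4\<close>, the exponent in the theorem.
\<close>

lemma antiderivative_on_subset:
  assumes "antiderivative_on I g F" and "J \<subseteq> I"
  shows "antiderivative_on J g F"
  using assms unfolding antiderivative_on_def by (blast intro: DERIV_subset)

lemma antiderivative_on_zero_constant:
  assumes "is_interval J" and "antiderivative_on J (\<lambda>_. 0) F"
  obtains k where "\<And>x. x \<in> J \<Longrightarrow> F x = k"
  using assms has_field_derivative_zero_constant[of J F]
  unfolding antiderivative_on_def is_interval_convex_1 by blast

lemma antiderivative_on_imp_continuous_on:
  "antiderivative_on J g F \<Longrightarrow> continuous_on J F"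
  unfolding antiderivative_on_def by (rule DERIV_continuous_on) blast

text \<open>
  The difference of two solutions is a Bernoulli function because
  \<open>c y\<^sup>2 - c yp\<^sup>2 = 2 c yp u + c u\<^sup>2\<close> for \<open>u = y - yp\<close>. This is an equivalence, so it
  serves both halves of the general solution.
\<close>

lemma riccati_solution_iff_bernoulli:
  assumes yp: "riccati_solution_on J a b c yp"
  shows "riccati_solution_on J a b c (\<lambda>x. u x + yp x) \<longleftrightarrow>
         antiderivative_on J (\<lambda>x. (b x + 2 * c x * yp x) * u x + c x * (u x)\<^sup>2) u"
proof -
  have "((\<lambda>t. u t + yp t) has_real_derivative a x + b x * (u x + yp x) + c x * (u x + yp x)\<^sup>2)
          (at x within J) \<longleftrightarrow>
        (u has_real_derivative (b x + 2 * c x * yp x) * u x + c x * (u x)\<^sup>2) (at x within J)"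
    (is "?L \<longleftrightarrow> ?R") if "x \<in> J" for x
  proof -
    have D: "(yp has_real_derivative a x + b x * yp x + c x * (yp x)\<^sup>2) (at x within J)"
      using yp that unfolding riccati_solution_on_def by blast
    have eq: "a x + b x * (u x + yp x) + c x * (u x + yp x)\<^sup>2 =
        ((b x + 2 * c x * yp x) * u x + c x * (u x)\<^sup>2) + (a x + b x * yp x + c x * (yp x)\<^sup>2)"
      by (simp add: power2_eq_square algebra_simps)
    show ?thesis
    proof
      assume ?L
      from DERIV_diff[OF this D] show ?R by (simp add: eq)
    next
      assume ?R
      from DERIV_add[OF this D] show ?L by (simp only: eq)
    qed
  qed
  then show ?thesis
    unfolding riccati_solution_on_def antiderivative_on_def by blast
qed

lemma bernoulli_solution_explicit:
  assumes E: "antiderivative_on J g E"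
    and H: "antiderivative_on J (\<lambda>x. c x * exp (E x)) H"
    and nz: "\<And>x. x \<in> J \<Longrightarrow> C - H x \<noteq> 0"
  shows "antiderivative_on J
           (\<lambda>x. g x * (exp (E x) / (C - H x)) + c x * (exp (E x) / (C - H x))\<^sup>2)
           (\<lambda>x. exp (E x) / (C - H x))"
  unfolding antiderivative_on_def
proof
  fix x assume x: "x \<in> J"
  have [derivative_intros]: "(E has_real_derivative g x) (at x within J)"
    "(H has_real_derivative c x * exp (E x)) (at x within J)"
    using E H x unfolding antiderivative_on_def by auto
  have "((\<lambda>x. exp (E x) / (C - H x)) has_real_derivative
          (exp (E x) * g x * (C - H x) + exp (E x) * (c x * exp (E x))) / (C - H x)\<^sup>2)
          (at x within J)"
    using nz[OF x] by (auto intro!: derivative_eq_intros simp: power2_eq_square)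
  moreover have "(exp (E x) * g x * d + exp (E x) * (c x * exp (E x))) / d\<^sup>2 =
      g x * (exp (E x) / d) + c x * (exp (E x) / d)\<^sup>2" if "d \<noteq> 0" for d
    using that by (simp add: power2_eq_square field_simps)
  ultimately show "((\<lambda>x. exp (E x) / (C - H x)) has_real_derivative
          g x * (exp (E x) / (C - H x)) + c x * (exp (E x) / (C - H x))\<^sup>2) (at x within J)"
    using nz[OF x] by simp
qed

text \<open>
  Freezing one factor of \<open>u\<^sup>2\<close> gives the linear equation \<open>u' = (g + c u) u\<close>. If
  \<open>M' = c u\<close>, then \<open>u exp (- E - M)\<close> has derivative zero, and the constant it equals
  decides whether \<open>u\<close> vanishes.
\<close>

lemma bernoulli_solution_zero_or_nonzero:
  assumes J: "is_interval J"
    and E: "antiderivative_on J g E"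
    and c: "continuous_on J c"
    and u: "antiderivative_on J (\<lambda>x. g x * u x + c x * (u x)\<^sup>2) u"
  shows "(\<forall>x\<in>J. u x = 0) \<or> (\<forall>x\<in>J. u x \<noteq> 0)"
proof -
  have "continuous_on J (\<lambda>x. c x * u x)"
    using c antiderivative_on_imp_continuous_on[OF u] by (intro continuous_intros)
  then obtain M where M: "antiderivative_on J (\<lambda>x. c x * u x) M"
    using antiderivative_on_exists[OF J] by blast
  have "antiderivative_on J (\<lambda>_. 0) (\<lambda>x. u x * exp (- E x - M x))"
    unfolding antiderivative_on_def
  proof
    fix x assume x: "x \<in> J"
    have [derivative_intros]: "(E has_real_derivative g x) (at x within J)"
      "(M has_real_derivative c x * u x) (at x within J)"
      "(u has_real_derivative g x * u x + c x * (u x)\<^sup>2) (at x within J)"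
      using E M u x unfolding antiderivative_on_def by auto
    show "((\<lambda>x. u x * exp (- E x - M x)) has_real_derivative 0) (at x within J)"
      by (auto intro!: derivative_eq_intros simp: power2_eq_square algebra_simps)
  qed
  then obtain k where k: "\<And>x. x \<in> J \<Longrightarrow> u x * exp (- E x - M x) = k"
    using antiderivative_on_zero_constant[OF J] by blast
  show ?thesis
    by (cases "k = 0") (use k in force)+
qed

lemma nonzero_bernoulli_solution_explicit:
  assumes J: "is_interval J"
    and E: "antiderivative_on J g E"
    and H: "antiderivative_on J (\<lambda>x. c x * exp (E x)) H"
    and u: "antiderivative_on J (\<lambda>x. g x * u x + c x * (u x)\<^sup>2) u"
    and nz: "\<And>x. x \<in> J \<Longrightarrow> u x \<noteq> 0"
  obtains C where "\<And>x. x \<in> J \<Longrightarrow> C - H x \<noteq> 0"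
    and "\<And>x. x \<in> J \<Longrightarrow> u x = exp (E x) / (C - H x)"
proof -
  have "antiderivative_on J (\<lambda>_. 0) (\<lambda>x. exp (E x) / u x + H x)"
    unfolding antiderivative_on_def
  proof
    fix x assume x: "x \<in> J"
    have [derivative_intros]: "(E has_real_derivative g x) (at x within J)"
      "(H has_real_derivative c x * exp (E x)) (at x within J)"
      "(u has_real_derivative g x * u x + c x * (u x)\<^sup>2) (at x within J)"
      using E H u x unfolding antiderivative_on_def by auto
    show "((\<lambda>x. exp (E x) / u x + H x) has_real_derivative 0) (at x within J)"
      using nz[OF x]
      by (auto intro!: derivative_eq_intros simp: power2_eq_square field_simps)
  qed
  then obtain C where C: "\<And>x. x \<in> J \<Longrightarrow> exp (E x) / u x + H x = C"
    using antiderivative_on_zero_constant[OF J] by blast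
  have eq: "C - H x = exp (E x) / u x" if "x \<in> J" for x
    using C[OF that] by linarith
  show thesis
    by (rule that[of C]) (use nz in \<open>simp_all add: eq\<close>)
qed

theorem riccati_general_solution_from_particular:
  assumes yp: "riccati_solution_on I a b c yp"
    and c: "continuous_on I c"
    and E: "antiderivative_on I (\<lambda>x. b x + 2 * c x * yp x) E"
    and H: "antiderivative_on I (\<lambda>x. c x * exp (E x)) H"
  shows "riccati_general_solution I a b c (\<lambda>x. exp (E x)) H yp"
  unfolding riccati_general_solution_def
proof (intro conjI allI impI; elim conjE)
  fix C J
  assume J: "J \<subseteq> I" "\<forall>x\<in>J. C - H x \<noteq> 0"
  have ypJ: "riccati_solution_on J a b c yp"
    using yp J unfolding riccati_solution_on_def by (blast intro: DERIV_subset)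
  show "riccati_solution_on J a b c (\<lambda>x. exp (E x) / (C - H x) + yp x)"
    unfolding riccati_solution_iff_bernoulli[OF ypJ]
    by (rule bernoulli_solution_explicit)
      (use J E H in \<open>auto intro: antiderivative_on_subset\<close>)
next
  fix J y
  assume J: "nondegenerate_interval J" "J \<subseteq> I" and y: "riccati_solution_on J a b c y"
  have int: "is_interval J" using J by (simp add: nondegenerate_interval_def)
  have ypJ: "riccati_solution_on J a b c yp"
    using yp J unfolding riccati_solution_on_def by (blast intro: DERIV_subset)
  define u where "u = (\<lambda>x. y x - yp x)"
  have u: "antiderivative_on J (\<lambda>x. (b x + 2 * c x * yp x) * u x + c x * (u x)\<^sup>2) u"
    using y riccati_solution_iff_bernoulli[OF ypJ, of u] by (simp add: u_def)
  note EJ = antiderivative_on_subset[OF E J(2)] and HJ = antiderivative_on_subset[OF H J(2)]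
  consider "\<forall>x\<in>J. u x = 0" | "\<forall>x\<in>J. u x \<noteq> 0"
    using bernoulli_solution_zero_or_nonzero[OF int EJ continuous_on_subset[OF c J(2)] u]
    by blast
  then show "(\<exists>C. \<forall>x\<in>J. C - H x \<noteq> 0 \<and> y x = exp (E x) / (C - H x) + yp x) \<or>
        (\<forall>x\<in>J. y x = yp x)"
  proof cases
    case 1
    then show ?thesis by (simp add: u_def)
  next
    case 2
    then obtain C where "\<And>x. x \<in> J \<Longrightarrow> C - H x \<noteq> 0"
      and "\<And>x. x \<in> J \<Longrightarrow> u x = exp (E x) / (C - H x)"
      using nonzero_bernoulli_solution_explicit[OF int EJ HJ u] by blast
    then have "\<forall>x\<in>J. C - H x \<noteq> 0 \<and> y x = exp (E x) / (C - H x) + yp x"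
      by (simp add: u_def diff_eq_eq)
    then show ?thesis by blast
  qed
qed

lemma smooth_on_imp_differentiable_on:
  assumes "smooth_on I f"
  shows "f differentiable_on I"
  using assms[unfolded smooth_on_def, rule_format, of 0] by simp

lemma differentiable_on_antiderivative_on:
  assumes "f differentiable_on I"
  shows "antiderivative_on I (deriv_within I f) f"
  using assms
  unfolding antiderivative_on_def deriv_within_def differentiable_on_def
    vector_derivative_works has_real_derivative_iff_has_vector_derivative by blast

text \<open>
  At \<open>y = f4 / (2 c)\<close> the terms \<open>a\<close> and \<open>f4\<^sup>2\<close> of the right-hand side cancel against
  those in \<open>b\<close>, leaving half the derivative of \<open>f4 / c\<close>.
\<close>

lemma riccati_particular_solution:
  assumes d: "(\<lambda>t. f4 t / c t) differentiable_on I"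
    and c0: "\<forall>x\<in>I. c x \<noteq> 0" and f0: "\<forall>x\<in>I. f4 x \<noteq> 0"
    and b: "\<forall>x\<in>I. b x = 1 / f4 x *
           (c x * deriv_within I (\<lambda>t. f4 t / c t) x - (f4 x)\<^sup>2 / 2 - 2 * a x * c x)"
  shows "riccati_solution_on I a b c (\<lambda>x. f4 x / (2 * c x))"
  unfolding riccati_solution_on_def
proof
  fix x assume x: "x \<in> I"
  define D where "D = deriv_within I (\<lambda>t. f4 t / c t) x"
  have "((\<lambda>t. f4 t / c t) has_real_derivative D) (at x within I)"
    using differentiable_on_antiderivative_on[OF d] x
    unfolding antiderivative_on_def D_def by blast
  from DERIV_cdivide[OF this, of 2]
  have "((\<lambda>t. f4 t / (2 * c t)) has_real_derivative D / 2) (at x within I)"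
    by (simp add: mult.commute)
  moreover have "D / 2 = a x + b x * (f4 x / (2 * c x)) + c x * (f4 x / (2 * c x))\<^sup>2"
    using c0 f0 b x by (simp add: D_def[symmetric] field_simps power2_eq_square)
  ultimately show "((\<lambda>t. f4 t / (2 * c t)) has_real_derivative
      a x + b x * (f4 x / (2 * c x)) + c x * (f4 x / (2 * c x))\<^sup>2) (at x within I)"
    by simp
qed

theorem theorem8:
  fixes I :: "real set" and a b c f4 E H :: "real \<Rightarrow> real"
  assumes "nondegenerate_interval I"
    and "smooth_on I a" and "smooth_on I b" and "smooth_on I c" and "smooth_on I f4"
    and "\<forall>x\<in>I. c x \<noteq> 0" and "\<forall>x\<in>I. f4 x \<noteq> 0"
    and "\<forall>x\<in>I. b x = 1 / f4 x *
           (c x * deriv_within I (\<lambda>t. f4 t / c t) x - (f4 x)\<^sup>2 / 2 - 2 * a x * c x)"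
    and "antiderivative_on I
           (\<lambda>\<phi>. 1 / f4 \<phi> *
              (c \<phi> * deriv_within I (\<lambda>t. f4 t / c t) \<phi> - (f4 \<phi>)\<^sup>2 / 2 - 2 * a \<phi> * c \<phi>)
              + f4 \<phi>) E"
    and "antiderivative_on I (\<lambda>\<psi>. c \<psi> * exp (E \<psi>)) H"
  shows "riccati_general_solution I a b c (\<lambda>x. exp (E x)) H (\<lambda>x. f4 x / (2 * c x))"
proof (rule riccati_general_solution_from_particular)
  have c: "c differentiable_on I" and f4: "f4 differentiable_on I"
    using assms(4,5) by (auto intro: smooth_on_imp_differentiable_on)
  show "continuous_on I c"
    using c by (rule differentiable_imp_continuous_on)
  have "(\<lambda>t. f4 t / c t) differentiable_on I"
    using c f4 assms(6) by (auto simp: differentiable_on_def intro!: differentiable_divide)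
  then show "riccati_solution_on I a b c (\<lambda>x. f4 x / (2 * c x))"
    using assms(6-8) by (rule riccati_particular_solution)
  show "antiderivative_on I (\<lambda>x. b x + 2 * c x * (f4 x / (2 * c x))) E"
    using assms(6,8,9) unfolding antiderivative_on_def by simp
  show "antiderivative_on I (\<lambda>x. c x * exp (E x)) H"
    by (rule assms(10))
qed

end
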